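(* Let $m,n\in\mathbb{N}$ with $n\ge m$. Then, for all $\alpha,\beta$ (variables, or complex numbers), $$\frac{\partial^m}{\partial x^m}\bigl[{}_{T}B_{n}^{(s,v)}(x+\alpha,y,z+\beta;\lambda)\bigr]=\sum_{r=0}^n m!\binom{n}{r}\binom{r}{m}\bigl[{}_{T}B_{r-m}^{(s,v)}(x,y,z;\lambda)\,C_{n-r}(\alpha,\beta)+{}_{T}B_{r-m}^{(c,v)}(x,y,z;\lambda)\,S_{n-r}(\alpha,\beta)\bigr],$$ where the terms with $r<m$ are zero (since $\binom{r}{m}=0$).
   Context: $\mathbb{N}=\{1,2,3,\dots\}$, $\mathbb{N}_0=\mathbb{N}\cup\{0\}$; $x,y,z$ are variables (taking complex values) and $\lambda\in\mathbb{C}\setminus\{0\}$. Let $\mathcal{U}(y,t)=\sum_{n\ge0}\mathcal{U}_n(y)\frac{t^n}{n!}$ be a power series in $t$ with coefficients depending on $y$ and $\mathcal{U}_0(y)\neq0$; the 2-variable general polynomials $T_n(x,y)$ are defined by $e^{xt}\mathcal{U}(y,t)=\sum_{n\ge0}T_n(x,y)\frac{t^n}{n!}$, with the normalization $T_0(x,y)=1$. The order $v$ is such that $\bigl(\frac{t}{\lambda e^t-1}\bigr)^v$ is a power series in $t$ ($v\in\mathbb{N}_0$ in general; $v\in\mathbb{C}$ allowed when $\lambda=1$, with the branch $1^v=1$ at $t=0$). The parametric kinds of generalized Apostol--Bernoulli polynomials are defined, as power series in $t$, by $$\Bigl(\frac{t}{\lambda e^t-1}\Bigr)^v e^{xt}\,\mathcal{U}(y,t)\cos(zt)=\sum_{n=0}^\infty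 {}_{T}B_{n}^{(c,v)}(x,y,z;\lambda)\frac{t^n}{n!},$$ $$\Bigl(\frac{t}{\lambda e^t-1}\Bigr)^v e^{xt}\,\mathcal{U}(y,t)\sin(zt)=\sum_{n=0}^\infty {}_{T}B_{n}^{(s,v)}(x,y,z;\lambda)\frac{t^n}{n!}.$$ The polynomials $C_n$ and $S_n$ are $$C_n(x,y)=\sum_{r=0}^{\lfloor n/2\rfloor}(-1)^r\binom{n}{2r}x^{n-2r}y^{2r},\qquad S_n(x,y)=\sum_{r=0}^{\lfloor (n-1)/2\rfloor}(-1)^r\binom{n}{2r+1}x^{n-2r-1}y^{2r+1},$$ with $S_0=0$ (empty sum); equivalently $e^{xt}\cos(yt)=\sum_{n\ge0}C_n(x,y)\frac{t^n}{n!}$ and $e^{xt}\sin(yt)=\sum_{n\ge0}S_n(x,y)\frac{t^n}{n!}$. *)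

theory Defs
  imports "HOL-Complex_Analysis.Complex_Analysis"
begin

text \<open>
  Generating functions are formal power series in \<open>t\<close> with complex coefficients, so that
  \<open>e\<^sup>x\<^sup>t\<close>, \<open>cos (z t)\<close>, \<open>sin (z t)\<close> are \<open>fps_exp x\<close>, \<open>fps_cos z\<close>, \<open>fps_sin z\<close>. The series
  \<open>\<U>(y,t)\<close> is given by a function \<open>U :: complex \<Rightarrow> complex fps\<close>; its numbers \<open>\<U>\<^sub>n(y)\<close> are the
  coefficients of \<open>t\<^sup>n / n!\<close>. The parameter \<open>\<lambda>\<close> is written \<open>lam\<close>.
\<close>

definition egf_coeff :: "complex fps \<Rightarrow> nat \<Rightarrow> complex" where
  "egf_coeff F n = fact n * fps_nth F n"

definition general_poly :: "(complex \<Rightarrow> complex fps) \<Rightarrow> nat \<Rightarrow> complex \<Rightarrow> complex \<Rightarrow> complex" where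
  "general_poly U n x y = egf_coeff (fps_exp x * U y) n"

text \<open>
  For \<open>\<lambda> = 1\<close> numerator and denominator both have subdegree 1; division of formal power series
  cancels the common factor \<open>t\<close>.
\<close>

definition apostol_gf :: "complex \<Rightarrow> complex fps" where
  "apostol_gf lam = fps_X / (fps_const lam * fps_exp 1 - 1)"

text \<open>
  The power \<open>(t / (\<lambda> e\<^sup>t - 1))\<^sup>v\<close>. For \<open>\<lambda> = 1\<close> the base \<open>f\<close> has constant term 1, and \<open>f\<^sup>v\<close> is
  the binomial series \<open>(1 + u)\<^sup>v\<close> at \<open>u = f - 1\<close>, which has constant term \<open>1\<^sup>v = 1\<close>. For
  \<open>\<lambda> \<noteq> 1\<close> the base has constant term 0; the definition is intended only for \<open>v \<in> \<nat>\<close>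
  (which contains 0).
\<close>

definition apostol_gf_power :: "complex \<Rightarrow> complex \<Rightarrow> complex fps" where
  "apostol_gf_power lam v =
     (if lam = 1 then fps_compose (fps_binomial v) (apostol_gf 1 - 1)
      else apostol_gf lam ^ (THE k. v = of_nat k))"

lemma apostol_gf_times: "apostol_gf lam * (fps_const lam * fps_exp 1 - 1) = fps_X"
proof -
  let ?g = "fps_const lam * fps_exp 1 - 1 :: complex fps"
  have n0: "fps_nth ?g 0 = lam - 1" and n1: "fps_nth ?g 1 = lam" by simp_all
  have nz: "?g \<noteq> 0"
  proof
    assume "?g = 0"
    hence "fps_nth ?g 0 = 0" "fps_nth ?g 1 = 0" by (simp_all only: fps_zero_nth)
    with n0 n1 show False by simp
  qed
  have "subdegree ?g \<le> 1"
  proof (cases "lam = 1")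
    case True
    hence "fps_nth ?g 1 \<noteq> 0" using n1 by simp
    thus ?thesis by (rule subdegree_leI)
  next
    case False
    hence "fps_nth ?g 0 \<noteq> 0" using n0 by simp
    hence "subdegree ?g \<le> 0" by (rule subdegree_leI)
    thus ?thesis by simp
  qed
  hence "?g dvd fps_X" using nz by (simp add: fps_dvd_iff)
  thus ?thesis unfolding apostol_gf_def by simp
qed

lemma apostol_gf_power_of_nat: "apostol_gf_power lam (of_nat k) = apostol_gf lam ^ k"
proof (cases "lam = 1")
  case True
  have "fps_nth (apostol_gf 1 * (fps_const 1 * fps_exp 1 - 1)) 1 = fps_nth fps_X 1"
    by (simp only: apostol_gf_times)
  hence c: "fps_nth (apostol_gf 1 - 1) 0 = 0"
    by (simp add: fps_mult_nth)
  have "fps_compose ((1 + fps_X) ^ k) (apostol_gf 1 - 1) = apostol_gf 1 ^ k"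
    unfolding fps_compose_power[OF c, symmetric] fps_compose_add_distrib
      fps_X_fps_compose_startby0[OF c]
    by simp
  thus ?thesis using True by (simp add: apostol_gf_power_def fps_binomial_of_nat)
next
  case False
  thus ?thesis by (simp add: apostol_gf_power_def)
qed

definition apostol_bernoulli_cos ::
  "(complex \<Rightarrow> complex fps) \<Rightarrow> complex \<Rightarrow> complex \<Rightarrow> nat \<Rightarrow> complex \<Rightarrow> complex \<Rightarrow> complex \<Rightarrow> complex" where
  "apostol_bernoulli_cos U lam v n x y z =
     egf_coeff (apostol_gf_power lam v * fps_exp x * U y * fps_cos z) n"

definition apostol_bernoulli_sin ::
  "(complex \<Rightarrow> complex fps) \<Rightarrow> complex \<Rightarrow> complex \<Rightarrow> nat \<Rightarrow> complex \<Rightarrow> complex \<Rightarrow> complex \<Rightarrow> complex" where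
  "apostol_bernoulli_sin U lam v n x y z =
     egf_coeff (apostol_gf_power lam v * fps_exp x * U y * fps_sin z) n"

definition C_poly :: "nat \<Rightarrow> complex \<Rightarrow> complex \<Rightarrow> complex" where
  "C_poly n x y =
     (\<Sum>r = 0..n div 2. (- 1) ^ r * of_nat (n choose (2 * r)) * x ^ (n - 2 * r) * y ^ (2 * r))"

definition S_poly :: "nat \<Rightarrow> complex \<Rightarrow> complex \<Rightarrow> complex" where
  "S_poly n x y =
     (if n = 0 then 0
      else \<Sum>r = 0..(n - 1) div 2.
        (- 1) ^ r * of_nat (n choose (2 * r + 1)) * x ^ (n - 2 * r - 1) * y ^ (2 * r + 1))"

end

theory Submission
  imports Defs
begin

text \<open>
  Differentiating in \<open>x\<close> multiplies the generating function by \<open>t\<close>, so the \<open>m\<close>-th derivative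
  of the \<open>n\<close>-th coefficient is \<open>m! (n choose m)\<close> times the coefficient of index \<open>n - m\<close>. The
  addition theorem for the sine splits the shifted generating function as the series at \<open>(x, z)\<close>
  times \<open>e\<^sup>\<alpha>\<^sup>t cos (\<beta> t)\<close> and \<open>e\<^sup>\<alpha>\<^sup>t sin (\<beta> t)\<close>; the coefficients of the products are binomial
  convolutions, and \<open>(n choose m) (n - m choose r - m) = (n choose r) (r choose m)\<close>.
\<close>

lemma egf_coeff_add: "egf_coeff (F + G) n = egf_coeff F n + egf_coeff G n"
  by (simp add: egf_coeff_def algebra_simps)

lemma egf_coeff_fps_exp: "egf_coeff (fps_exp x) n = x ^ n"
  by (simp add: egf_coeff_def)

lemma egf_coeff_fps_cos:
  "egf_coeff (fps_cos y) n = (if even n then (- 1) ^ (n div 2) * y ^ n else 0)"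
  by (simp add: egf_coeff_def fps_cos_def)

lemma egf_coeff_fps_sin:
  "egf_coeff (fps_sin y) n = (if even n then 0 else (- 1) ^ ((n - 1) div 2) * y ^ n)"
  by (simp add: egf_coeff_def fps_sin_def)

lemma egf_coeff_mult:
  "egf_coeff (F * G) n =
     (\<Sum>k = 0..n. of_nat (n choose k) * egf_coeff F k * egf_coeff G (n - k))"
  unfolding egf_coeff_def fps_mult_nth sum_distrib_left
  by (rule sum.cong) (auto simp: binomial_fact field_simps)

lemma sum_even_indices:
  fixes f :: "nat \<Rightarrow> 'a::comm_monoid_add"
  shows "(\<Sum>k = 0..n. if even k then f k else 0) = (\<Sum>r = 0..n div 2. f (2 * r))"
proof -
  have "(\<Sum>k = 0..n. if even k then f k else 0) = (\<Sum>k \<in> {k \<in> {0..n}. even k}. f k)"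
    by (rule sum.inter_filter[symmetric]) simp
  also have "\<dots> = (\<Sum>r = 0..n div 2. f (2 * r))"
    by (rule sum.reindex_bij_witness[of _ "\<lambda>r. 2 * r" "\<lambda>k. k div 2"]) auto
  finally show ?thesis .
qed

text \<open>For \<open>n = 0\<close> the truncated bound \<open>(n - 1) div 2\<close> is still 0, so
  the right side would be the stray term \<open>f 1\<close>; this is the same exception as in
  \<open>S_poly\<close>.\<close>

lemma sum_odd_indices:
  fixes f :: "nat \<Rightarrow> 'a::comm_monoid_add"
  assumes "n \<noteq> 0"
  shows "(\<Sum>k = 0..n. if even k then 0 else f k) = (\<Sum>r = 0..(n - 1) div 2. f (2 * r + 1))"
proof -
  have "(\<Sum>k = 0..n. if even k then 0 else f k) = (\<Sum>k = 0..n. if odd k then f k else 0)"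
    by (rule sum.cong) auto
  also have "\<dots> = (\<Sum>k \<in> {k \<in> {0..n}. odd k}. f k)"
    by (rule sum.inter_filter[symmetric]) simp
  also have "\<dots> = (\<Sum>r = 0..(n - 1) div 2. f (2 * r + 1))"
    by (rule sum.reindex_bij_witness[of _ "\<lambda>r. 2 * r + 1" "\<lambda>k. k div 2"])
      (use assms in \<open>auto elim!: oddE\<close>)
  finally show ?thesis .
qed

lemma egf_coeff_exp_cos: "egf_coeff (fps_exp x * fps_cos y) n = C_poly n x y"
proof -
  have "egf_coeff (fps_exp x * fps_cos y) n =
      (\<Sum>k = 0..n. if even k then (- 1) ^ (k div 2) * of_nat (n choose k) * x ^ (n - k) * y ^ k else 0)"
    \<comment> \<open>With the cosine as first factor the convolution index is the exponent of
      \<open>y\<close>, as in \<open>C_poly\<close>.\<close>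
    unfolding mult.commute[of "fps_exp x"] egf_coeff_mult egf_coeff_fps_cos egf_coeff_fps_exp
    by (rule sum.cong) auto
  thus ?thesis
    by (simp add: sum_even_indices C_poly_def)
qed

lemma egf_coeff_exp_sin: "egf_coeff (fps_exp x * fps_sin y) n = S_poly n x y"
proof (cases "n = 0")
  case True
  thus ?thesis by (simp add: egf_coeff_def S_poly_def)
next
  case False
  have "egf_coeff (fps_exp x * fps_sin y) n =
      (\<Sum>k = 0..n. if even k then 0
         else (- 1) ^ ((k - 1) div 2) * of_nat (n choose k) * x ^ (n - k) * y ^ k)"
    unfolding mult.commute[of "fps_exp x"] egf_coeff_mult egf_coeff_fps_sin egf_coeff_fps_exp
    by (rule sum.cong) auto
  thus ?thesis
    using False by (simp add: sum_odd_indices S_poly_def)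
qed

text \<open>By convolution the coefficient is a polynomial in \<open>x\<close>, differentiated term
  by term; the absorption identity then extracts the factor \<open>n\<close>. At
  \<open>n = 0\<close> this factor cancels the truncated index \<open>n - 1\<close>.\<close>

lemma has_field_derivative_egf_coeff_exp:
  "((\<lambda>x. egf_coeff (fps_exp x * F) n) has_field_derivative
     of_nat n * egf_coeff (fps_exp x * F) (n - 1)) (at x)"
proof (cases n)
  case 0
  thus ?thesis by (simp add: egf_coeff_def)
next
  case (Suc k)
  have "((\<lambda>x. \<Sum>i = 0..Suc k. of_nat (Suc k choose i) * x ^ i * egf_coeff F (Suc k - i))
      has_field_derivative
      (\<Sum>i = 0..Suc k. of_nat (Suc k choose i) * (of_nat i * x ^ (i - 1)) * egf_coeff F (Suc k - i)))
      (at x)"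
  proof (intro DERIV_sum DERIV_cmult_right DERIV_cmult)
    show "((\<lambda>x. x ^ i) has_field_derivative of_nat i * x ^ (i - 1)) (at x)" for i
      using DERIV_power[OF DERIV_ident, where n = i] by simp
  qed
  \<comment> \<open>The term \<open>i = 0\<close> vanishes through its factor
    \<open>of_nat i\<close>, and the others are shifted down by one.\<close>
  also have "(\<Sum>i = 0..Suc k. of_nat (Suc k choose i) * (of_nat i * x ^ (i - 1)) * egf_coeff F (Suc k - i))
      = (\<Sum>i = 0..k. of_nat (Suc i * (Suc k choose Suc i)) * x ^ i * egf_coeff F (k - i))"
    unfolding sum.atLeast0_atMost_Suc_shift by (simp add: algebra_simps)
  also have "\<dots> = of_nat (Suc k) * (\<Sum>i = 0..k. of_nat (k choose i) * x ^ i * egf_coeff F (k - i))"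
    unfolding Suc_times_binomial sum_distrib_left of_nat_mult by (simp only: mult_ac)
  finally show ?thesis
    by (simp only: Suc egf_coeff_mult egf_coeff_fps_exp diff_Suc_1)
qed

text \<open>The prefactor is the falling factorial of \<open>n\<close> of length \<open>m\<close>.
  An equality of functions lets the induction hypothesis be rewritten under
  \<open>deriv\<close>.\<close>

lemma higher_deriv_egf_coeff_exp:
  "(deriv ^^ m) (\<lambda>x. egf_coeff (fps_exp x * F) n) =
     (\<lambda>x. fact m * of_nat (n choose m) * egf_coeff (fps_exp x * F) (n - m))"
proof (induction m)
  case 0
  show ?case by simp
next
  case (Suc m)
  have binom: "(n choose m) * (n - m) = Suc m * (n choose Suc m)"
    by (metis binomial_absorb_comp binomial_absorption mult.commute)
  have coeff: "fact m * of_nat (n choose m) * of_nat (n - m) =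
      (fact (Suc m) * of_nat (n choose Suc m) :: complex)"
    using arg_cong[OF binom, of "of_nat :: nat \<Rightarrow> complex"]
    unfolding fact_Suc of_nat_mult by (simp only: mult_ac)
  have "deriv (\<lambda>x. fact m * of_nat (n choose m) * egf_coeff (fps_exp x * F) (n - m)) x =
      fact m * of_nat (n choose m) * (of_nat (n - m) * egf_coeff (fps_exp x * F) (n - m - 1))" for x
    by (intro DERIV_imp_deriv DERIV_cmult has_field_derivative_egf_coeff_exp)
  hence "deriv (\<lambda>x. fact m * of_nat (n choose m) * egf_coeff (fps_exp x * F) (n - m)) =
      (\<lambda>x. fact (Suc m) * of_nat (n choose Suc m) * egf_coeff (fps_exp x * F) (n - Suc m))"
    unfolding coeff[symmetric] by (simp add: fun_eq_iff mult.assoc)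
  thus ?case
    by (simp only: funpow.simps o_apply Suc.IH)
qed

lemma apostol_bernoulli_sin_add:
  "apostol_bernoulli_sin U lam v n (x + \<alpha>) y (z + \<beta>) =
     (\<Sum>k = 0..n. of_nat (n choose k) *
        (apostol_bernoulli_sin U lam v k x y z * C_poly (n - k) \<alpha> \<beta> +
         apostol_bernoulli_cos U lam v k x y z * S_poly (n - k) \<alpha> \<beta>))"
proof -
  have "apostol_gf_power lam v * fps_exp (x + \<alpha>) * U y * fps_sin (z + \<beta>) =
      (apostol_gf_power lam v * fps_exp x * U y * fps_sin z) * (fps_exp \<alpha> * fps_cos \<beta>) +
      (apostol_gf_power lam v * fps_exp x * U y * fps_cos z) * (fps_exp \<alpha> * fps_sin \<beta>)"
    by (simp add: fps_exp_add_mult fps_sin_add algebra_simps)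
  thus ?thesis
    unfolding apostol_bernoulli_sin_def apostol_bernoulli_cos_def
    \<comment> \<open>Fixing the second factor confines the convolution rule to the intended two
      products.\<close>
    by (simp only: egf_coeff_add
        egf_coeff_mult[where G = "fps_exp \<alpha> * fps_cos \<beta>"]
        egf_coeff_mult[where G = "fps_exp \<alpha> * fps_sin \<beta>"]
        egf_coeff_exp_cos egf_coeff_exp_sin sum.distrib distrib_left)
      (simp only: mult.assoc)
qed

lemma higher_deriv_apostol_bernoulli_sin:
  "(deriv ^^ m) (\<lambda>x. apostol_bernoulli_sin U lam v n (x + \<alpha>) y z) x =
     fact m * of_nat (n choose m) * apostol_bernoulli_sin U lam v (n - m) (x + \<alpha>) y z"
proof -
  \<comment> \<open>Moving \<open>fps_exp \<alpha>\<close> into the factor independent of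
    \<open>x\<close> reduces the shifted argument to the unshifted case.\<close>
  have "apostol_bernoulli_sin U lam v k (x + \<alpha>) y z =
      egf_coeff (fps_exp x * (apostol_gf_power lam v * fps_exp \<alpha> * U y * fps_sin z)) k" for k x
    by (simp add: apostol_bernoulli_sin_def fps_exp_add_mult mult_ac)
  thus ?thesis
    by (simp only: higher_deriv_egf_coeff_exp)
qed

theorem theorem4p1:
  fixes U :: "complex \<Rightarrow> complex fps"
    and lam v x y z \<alpha> \<beta> :: complex
    and m n :: nat
  assumes "\<And>y. fps_nth (U y) 0 \<noteq> 0"
    and "\<And>x y. general_poly U 0 x y = 1"
    and "lam \<noteq> 0"
    and "v \<in> \<nat> \<or> lam = 1"
    and "1 \<le> m" and "m \<le> n"
  shows "(deriv ^^ m) (\<lambda>x. apostol_bernoulli_sin U lam v n (x + \<alpha>) y (z + \<beta>)) x =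
    (\<Sum>r = 0..n. fact m * of_nat (n choose r) * of_nat (r choose m) *
       (apostol_bernoulli_sin U lam v (r - m) x y z * C_poly (n - r) \<alpha> \<beta> +
        apostol_bernoulli_cos U lam v (r - m) x y z * S_poly (n - r) \<alpha> \<beta>))"
proof -
  define B where "B k j = apostol_bernoulli_sin U lam v k x y z * C_poly j \<alpha> \<beta> +
    apostol_bernoulli_cos U lam v k x y z * S_poly j \<alpha> \<beta>" for k j
  have "(\<Sum>r = 0..n. fact m * of_nat (n choose r) * of_nat (r choose m) * B (r - m) (n - r)) =
      (\<Sum>r = m..n. fact m * of_nat (n choose r) * of_nat (r choose m) * B (r - m) (n - r))"
    \<comment> \<open>For \<open>r < m\<close> the binomial \<open>r choose m\<close> is 0, which
      also discards the truncated indices \<open>r - m\<close>.\<close>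
    by (rule sum.mono_neutral_right) auto
  also have "\<dots> = (\<Sum>r = m..n. fact m * of_nat (n choose m) *
      (of_nat (n - m choose (r - m)) * B (r - m) (n - r)))"
    by (rule sum.cong) (simp_all add: choose_mult mult.assoc flip: of_nat_mult)
  also have "\<dots> = (\<Sum>k = 0..n - m. fact m * of_nat (n choose m) *
      (of_nat (n - m choose k) * B k (n - m - k)))"
    \<comment> \<open>Here \<open>k = r - m\<close>. For \<open>m > n\<close> the left range would
      be empty while \<open>{0..n - m}\<close> still contains 0.\<close>
    using \<open>m \<le> n\<close>
    by (intro sum.reindex_bij_witness[of _ "\<lambda>k. k + m" "\<lambda>r. r - m"]) auto
  also have "\<dots> = fact m * of_nat (n choose m) *
      apostol_bernoulli_sin U lam v (n - m) (x + \<alpha>) y (z + \<beta>)"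
    by (simp only: apostol_bernoulli_sin_add B_def sum_distrib_left)
  finally show ?thesis
    by (simp only: higher_deriv_apostol_bernoulli_sin B_def)
qed

end
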